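(* Among all relaxed unsplit stable assignments $x$ of an instance, the machine-optimal relaxed unsplit stable assignment $x_{\text{mopt}}$ minimizes the total congestion $\sum_{m\in M}\max\bigl(0,\,x(m)-q(m)\bigr)$.
   Context: An instance consists of a finite bipartite graph $G=(J\cup M,E)$ between jobs $J$ and machines $M$; each job $j$ has size $q(j)>0$, each machine $m$ capacity $q(m)>0$; each job strictly ranks its adjacent machines and each machine strictly ranks its adjacent jobs. $M$ contains a dummy machine $m_d$ adjacent to every job, ranked last by every job, with $q(m_d)>\sum_{j\in J}q(j)$. An assignment is $x:E\to\mathbb{R}_{\ge0}$, $x(j)=\sum_m x(jm)$, $x(m)=\sum_j x(jm)$. It is unsplit if $x(jm)\in\{0,q(j)\}$ for all $jm$ and $x(j)\le q(j)$ for all $j$. An unsplit $x$ is a relaxed unsplit assignment if for every machine $m$ with at least one assigned job, $x(m)-q(j_m)<q(m)$, where $j_m$ is the assigned job $m$ likes least. A relaxed unsplit assignment $x$ is stable if for every edge $jm$ with $x(jm)=0$, either $j$ is assigned to a machine it prefers to $m$, or $\sum_{j':m\text{ prefers } j'\text{ to } j}x(j'm)\ge q(m)$. For unsplit $x_1,x_2$, machine $m$ weakly prefers $x_1$ to $x_2$ if either no edge incident to $m$ is positive in exactly one of $x_1,x_2$, or the edge $m$ ranks best among those incident edges positive in exactly one of them is positive in $x_1$. The machine-optimal relaxed unsplit stable assignment $x_{\text{mopt}}$ is the (existing) relaxed unsplit stable assignment that every machine weakly prefers to every relaxed unsplit stable assignment. *)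

theory Defs
  imports Complex_Main
begin

text \<open>
  Jobs and machines live in two different types, so every edge set is bipartite.
  A pair in \<open>job_pref I j\<close> or \<open>mach_pref I m\<close> lists the preferred element first.
\<close>

record ('j, 'm) alloc_inst =
  jobs :: "'j set"
  machines :: "'m set"
  edges :: "('j \<times> 'm) set"
  job_size :: "'j \<Rightarrow> real"
  mach_cap :: "'m \<Rightarrow> real"
  job_pref :: "'j \<Rightarrow> ('m \<times> 'm) set"
  mach_pref :: "'m \<Rightarrow> ('j \<times> 'j) set"
  dummy :: 'm

definition adj_machines :: "('j, 'm) alloc_inst \<Rightarrow> 'j \<Rightarrow> 'm set" where
  "adj_machines I j = {m. (j, m) \<in> edges I}"

definition adj_jobs :: "('j, 'm) alloc_inst \<Rightarrow> 'm \<Rightarrow> 'j set" where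
  "adj_jobs I m = {j. (j, m) \<in> edges I}"

definition valid_inst :: "('j, 'm) alloc_inst \<Rightarrow> bool" where
  "valid_inst I \<longleftrightarrow>
     finite (jobs I) \<and> finite (machines I) \<and>
     edges I \<subseteq> jobs I \<times> machines I \<and>
     (\<forall>j\<in>jobs I. job_size I j > 0) \<and>
     (\<forall>m\<in>machines I. mach_cap I m > 0) \<and>
     (\<forall>j\<in>jobs I. strict_linear_order_on (adj_machines I j) (job_pref I j)) \<and>
     (\<forall>m\<in>machines I. strict_linear_order_on (adj_jobs I m) (mach_pref I m)) \<and>
     dummy I \<in> machines I \<and>
     (\<forall>j\<in>jobs I. (j, dummy I) \<in> edges I) \<and>
     (\<forall>j\<in>jobs I. \<forall>m\<in>adj_machines I j. m \<noteq> dummy I \<longrightarrow> (m, dummy I) \<in> job_pref I j) \<and>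
     mach_cap I (dummy I) > (\<Sum>j\<in>jobs I. job_size I j)"

text \<open>
  An assignment is a function on pairs of which only the values on the edges matter.
\<close>

definition assignment :: "('j, 'm) alloc_inst \<Rightarrow> ('j \<times> 'm \<Rightarrow> real) \<Rightarrow> bool" where
  "assignment I x \<longleftrightarrow> (\<forall>e\<in>edges I. x e \<ge> 0)"

definition job_load :: "('j, 'm) alloc_inst \<Rightarrow> ('j \<times> 'm \<Rightarrow> real) \<Rightarrow> 'j \<Rightarrow> real" where
  "job_load I x j = (\<Sum>m\<in>adj_machines I j. x (j, m))"

definition mach_load :: "('j, 'm) alloc_inst \<Rightarrow> ('j \<times> 'm \<Rightarrow> real) \<Rightarrow> 'm \<Rightarrow> real" where
  "mach_load I x m = (\<Sum>j\<in>adj_jobs I m. x (j, m))"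

definition unsplit :: "('j, 'm) alloc_inst \<Rightarrow> ('j \<times> 'm \<Rightarrow> real) \<Rightarrow> bool" where
  "unsplit I x \<longleftrightarrow> assignment I x \<and>
     (\<forall>(j, m)\<in>edges I. x (j, m) \<in> {0, job_size I j}) \<and>
     (\<forall>j\<in>jobs I. job_load I x j \<le> job_size I j)"

definition assigned_jobs :: "('j, 'm) alloc_inst \<Rightarrow> ('j \<times> 'm \<Rightarrow> real) \<Rightarrow> 'm \<Rightarrow> 'j set" where
  "assigned_jobs I x m = {j \<in> adj_jobs I m. x (j, m) > 0}"

definition least_liked :: "('j, 'm) alloc_inst \<Rightarrow> ('j \<times> 'm \<Rightarrow> real) \<Rightarrow> 'm \<Rightarrow> 'j \<Rightarrow> bool" where
  "least_liked I x m j \<longleftrightarrow> j \<in> assigned_jobs I x m \<and>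
     (\<forall>j'\<in>assigned_jobs I x m. j' \<noteq> j \<longrightarrow> (j', j) \<in> mach_pref I m)"

text \<open>
  In a valid instance a machine has exactly one least liked assigned job as soon as it has an
  assigned job, so the quantification over \<open>j\<close> below speaks about that job only.
\<close>

definition relaxed_unsplit :: "('j, 'm) alloc_inst \<Rightarrow> ('j \<times> 'm \<Rightarrow> real) \<Rightarrow> bool" where
  "relaxed_unsplit I x \<longleftrightarrow> unsplit I x \<and>
     (\<forall>m\<in>machines I. \<forall>j. least_liked I x m j \<longrightarrow> mach_load I x m - job_size I j < mach_cap I m)"

definition relaxed_unsplit_stable :: "('j, 'm) alloc_inst \<Rightarrow> ('j \<times> 'm \<Rightarrow> real) \<Rightarrow> bool" where
  "relaxed_unsplit_stable I x \<longleftrightarrow> relaxed_unsplit I x \<and>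
     (\<forall>(j, m)\<in>edges I. x (j, m) = 0 \<longrightarrow>
        (\<exists>m'\<in>adj_machines I j. x (j, m') > 0 \<and> (m', m) \<in> job_pref I j) \<or>
        (\<Sum>j' | j' \<in> adj_jobs I m \<and> (j', j) \<in> mach_pref I m. x (j', m)) \<ge> mach_cap I m)"

definition differing_jobs ::
  "('j, 'm) alloc_inst \<Rightarrow> 'm \<Rightarrow> ('j \<times> 'm \<Rightarrow> real) \<Rightarrow> ('j \<times> 'm \<Rightarrow> real) \<Rightarrow> 'j set" where
  "differing_jobs I m x1 x2 = {j \<in> adj_jobs I m. (x1 (j, m) > 0) \<noteq> (x2 (j, m) > 0)}"

definition weakly_prefers ::
  "('j, 'm) alloc_inst \<Rightarrow> 'm \<Rightarrow> ('j \<times> 'm \<Rightarrow> real) \<Rightarrow> ('j \<times> 'm \<Rightarrow> real) \<Rightarrow> bool" where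
  "weakly_prefers I m x1 x2 \<longleftrightarrow> differing_jobs I m x1 x2 = {} \<or>
     (\<exists>j\<in>differing_jobs I m x1 x2.
        (\<forall>j'\<in>differing_jobs I m x1 x2. j' \<noteq> j \<longrightarrow> (j, j') \<in> mach_pref I m) \<and> x1 (j, m) > 0)"

definition machine_optimal :: "('j, 'm) alloc_inst \<Rightarrow> ('j \<times> 'm \<Rightarrow> real) \<Rightarrow> bool" where
  "machine_optimal I x \<longleftrightarrow> relaxed_unsplit_stable I x \<and>
     (\<forall>y. relaxed_unsplit_stable I y \<longrightarrow> (\<forall>m\<in>machines I. weakly_prefers I m x y))"

definition total_congestion :: "('j, 'm) alloc_inst \<Rightarrow> ('j \<times> 'm \<Rightarrow> real) \<Rightarrow> real" where
  "total_congestion I x = (\<Sum>m\<in>machines I. max 0 (mach_load I x m - mach_cap I m))"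

end

theory Submission
  imports Defs
begin

text \<open>
  In a stable assignment every job is placed, because the dummy machine can never fill up. Hence
  the total load is the same for all stable assignments, and minimising the congestion amounts to
  maximising the sum over all machines of the minimum of load and capacity. The machine-optimal
  assignment maximises every single term of this sum. This follows once one knows that every job
  finds it at most as good as any other stable assignment \<open>y\<close>: a job placed on \<open>m\<close> by
  \<open>y\<close> but not by the machine-optimal assignment then certifies that \<open>m\<close> is saturated in the
  latter.

  That the machine-optimal assignment is job-pessimal is obtained by constructing a job-pessimal
  stable assignment as a least fixed point in the style of Fleiner: filling a machine with its best
  available jobs until its capacity is reached is a substitutable choice function. Every machine
  weakly prefers the job-pessimal assignment to the machine-optimal one, so the two coincide.
\<close>

section \<open>Extremal elements of finite linear orders\<close>

text \<open>Preferences list the better element first, so a preference relation yields the worst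
  element of \<open>A\<close> and its converse the best one. Both uses occur below.\<close>

lemma finite_linear_order_greatest:
  assumes "finite A" "A \<noteq> {}" "trans r" "total_on A r"
  shows "\<exists>w\<in>A. \<forall>a\<in>A. a \<noteq> w \<longrightarrow> (a, w) \<in> r"
  using assms(1,2,4)
proof (induction rule: finite_ne_induct)
  case (singleton a)
  then show ?case by simp
next
  case (insert a F)
  then obtain w where w: "w \<in> F" "\<forall>b\<in>F. b \<noteq> w \<longrightarrow> (b, w) \<in> r"
    using total_on_subset[of "insert a F" r F] by auto
  have "a \<noteq> w" using w insert by auto
  then have "(a, w) \<in> r \<or> (w, a) \<in> r"
    using insert.prems w(1) by (auto simp: total_on_def)
  then show ?case
  proof
    assume "(a, w) \<in> r"
    then show ?case using w by auto
  next
    assume "(w, a) \<in> r"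
    then have "\<forall>b\<in>F. (b, a) \<in> r" using w assms(3) by (metis transD)
    then show ?case by auto
  qed
qed

section \<open>Matchings as edge sets and the operators of deferred acceptance\<close>

text \<open>Every edge of \<open>A\<close> counts with the full job size, so \<open>A\<close> may
  also be a pool of available edges in which a job occurs with several machines.\<close>

definition better_load :: "('j, 'm) alloc_inst \<Rightarrow> ('j \<times> 'm) set \<Rightarrow> 'm \<Rightarrow> 'j \<Rightarrow> real" where
  "better_load I A m j = (\<Sum>j' | (j', m) \<in> A \<and> (j', j) \<in> mach_pref I m. job_size I j')"

text \<open>Combinatorial form of relaxed unsplit stability. The capacity bound is required at every
  matched job, which amounts to requiring it at the least liked one, where
  \<open>better_load\<close> is largest. Exactly one machine per job is the effect of the dummy
  machine.\<close>

definition stable_matching :: "('j, 'm) alloc_inst \<Rightarrow> ('j \<times> 'm) set \<Rightarrow> bool" where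
  "stable_matching I A \<longleftrightarrow> A \<subseteq> edges I \<and>
     (\<forall>j\<in>jobs I. \<exists>!m. (j, m) \<in> A) \<and>
     (\<forall>j m. (j, m) \<in> A \<longrightarrow> better_load I A m j < mach_cap I m) \<and>
     (\<forall>j m. (j, m) \<in> edges I - A \<longrightarrow>
        (\<exists>m'. (j, m') \<in> A \<and> (m', m) \<in> job_pref I j) \<or> mach_cap I m \<le> better_load I A m j)"

definition support :: "('j, 'm) alloc_inst \<Rightarrow> ('j \<times> 'm \<Rightarrow> real) \<Rightarrow> ('j \<times> 'm) set" where
  "support I x = {e \<in> edges I. x e > 0}"

definition matching_assignment ::
  "('j, 'm) alloc_inst \<Rightarrow> ('j \<times> 'm) set \<Rightarrow> 'j \<times> 'm \<Rightarrow> real" where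
  "matching_assignment I A = (\<lambda>(j, m). if (j, m) \<in> A then job_size I j else 0)"

text \<open>The edge itself need not lie in \<open>S\<close>. This makes the operator antitone, and
  intersecting it with \<open>S\<close> gives the best offers of the jobs.\<close>

definition not_worse_for_jobs ::
  "('j, 'm) alloc_inst \<Rightarrow> ('j \<times> 'm) set \<Rightarrow> ('j \<times> 'm) set" where
  "not_worse_for_jobs I S =
     {(j, m) \<in> edges I. \<forall>m'. (j, m') \<in> S \<longrightarrow> (m', m) \<notin> job_pref I j}"

text \<open>The edges a machine would take when filling up in rank order from the pool
  \<open>T\<close>. Edges outside \<open>T\<close> are tested as well, which makes the operator
  antitone on sets of edges.\<close>

definition acceptable_to_machines ::
  "('j, 'm) alloc_inst \<Rightarrow> ('j \<times> 'm) set \<Rightarrow> ('j \<times> 'm) set" where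
  "acceptable_to_machines I T = {(j, m) \<in> edges I. better_load I T m j < mach_cap I m}"

text \<open>The edges offered to the jobs at the end of the machine-proposing deferred acceptance.\<close>

definition least_offers :: "('j, 'm) alloc_inst \<Rightarrow> ('j \<times> 'm) set" where
  "least_offers I = lfp (\<lambda>S. acceptable_to_machines I (not_worse_for_jobs I S))"

text \<open>Each job takes its best offer from the fixed point.\<close>

definition pessimal_matching :: "('j, 'm) alloc_inst \<Rightarrow> ('j \<times> 'm) set" where
  "pessimal_matching I = least_offers I \<inter> not_worse_for_jobs I (least_offers I)"

section \<open>Basic facts about a valid instance\<close>

locale valid_instance =
  fixes I :: "('j, 'm) alloc_inst"
  assumes valid: "valid_inst I"
begin

lemma finite_jobs: "finite (jobs I)" and finite_machines: "finite (machines I)"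
  and edges_subset: "edges I \<subseteq> jobs I \<times> machines I"
  and job_size_pos: "j \<in> jobs I \<Longrightarrow> job_size I j > 0"
  and dummy_edge: "j \<in> jobs I \<Longrightarrow> (j, dummy I) \<in> edges I"
  and dummy_cap: "(\<Sum>j\<in>jobs I. job_size I j) < mach_cap I (dummy I)"
  using valid by (auto simp: valid_inst_def)

lemma edge_job: "(j, m) \<in> edges I \<Longrightarrow> j \<in> jobs I"
  and edge_machine: "(j, m) \<in> edges I \<Longrightarrow> m \<in> machines I"
  using edges_subset by auto

lemma job_pref_order:
  assumes "j \<in> jobs I"
  shows "trans (job_pref I j)" "irrefl (job_pref I j)" "total_on (adj_machines I j) (job_pref I j)"
  using valid assms by (auto simp: valid_inst_def strict_linear_order_on_def)

lemma mach_pref_order: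
  assumes "m \<in> machines I"
  shows "trans (mach_pref I m)" "irrefl (mach_pref I m)" "total_on (adj_jobs I m) (mach_pref I m)"
  using valid assms by (auto simp: valid_inst_def strict_linear_order_on_def)

lemma finite_adj_jobs: "finite (adj_jobs I m)"
  by (rule finite_subset[OF _ finite_jobs]) (auto simp: adj_jobs_def edge_job)

lemma finite_adj_machines: "finite (adj_machines I j)"
  by (rule finite_subset[OF _ finite_machines]) (auto simp: adj_machines_def edge_machine)

lemma finite_matched:
  assumes "A \<subseteq> edges I"
  shows "finite {j. (j, m) \<in> A \<and> P j}"
  by (rule finite_subset[OF _ finite_jobs]) (use assms edge_job in blast)

lemma matched_size_nonneg:
  assumes "A \<subseteq> edges I" "(j, m) \<in> A"
  shows "0 \<le> job_size I j"
  using assms edge_job job_size_pos by (blast intro: less_imp_le)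

lemma better_load_mono:
  assumes "A \<subseteq> B" "B \<subseteq> edges I"
  shows "better_load I A m j \<le> better_load I B m j"
  unfolding better_load_def
proof (rule sum_mono2)
  show "finite {j'. (j', m) \<in> B \<and> (j', j) \<in> mach_pref I m}"
    using finite_matched[OF assms(2)] .
qed (use assms matched_size_nonneg[OF assms(2)] in auto)

section \<open>The job-pessimal stable matching\<close>

lemma not_worse_for_jobs_subset: "not_worse_for_jobs I S \<subseteq> edges I"
  by (auto simp: not_worse_for_jobs_def)

text \<open>The composition of two antitone operators is monotone, so the least fixed point
  satisfies its equation.\<close>

lemma least_offers_unfold:
  "least_offers I = acceptable_to_machines I (not_worse_for_jobs I (least_offers I))"
proof -
  have "mono (\<lambda>S. acceptable_to_machines I (not_worse_for_jobs I S))"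
  proof (rule monoI)
    fix S S' :: "('j \<times> 'm) set"
    assume "S \<subseteq> S'"
    then have "not_worse_for_jobs I S' \<subseteq> not_worse_for_jobs I S"
      by (auto simp: not_worse_for_jobs_def)
    then have "better_load I (not_worse_for_jobs I S') m j
        \<le> better_load I (not_worse_for_jobs I S) m j" for m j
      using better_load_mono not_worse_for_jobs_subset by blast
    then show "acceptable_to_machines I (not_worse_for_jobs I S)
        \<subseteq> acceptable_to_machines I (not_worse_for_jobs I S')"
      by (auto simp: acceptable_to_machines_def intro: le_less_trans)
  qed
  then show ?thesis
    unfolding least_offers_def by (rule lfp_unfold)
qed

text \<open>The fixed point equation turns the jobs' choice from the offers into the machines'
  choice from the edges that the jobs would not refuse.\<close>

lemma pessimal_matching_iff:
  "(j, m) \<in> pessimal_matching I \<longleftrightarrow>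
     (j, m) \<in> not_worse_for_jobs I (least_offers I) \<and>
     better_load I (not_worse_for_jobs I (least_offers I)) m j < mach_cap I m"
proof -
  have "(j, m) \<in> least_offers I \<longleftrightarrow> (j, m) \<in> edges I \<and>
      better_load I (not_worse_for_jobs I (least_offers I)) m j < mach_cap I m"
    by (subst least_offers_unfold) (simp add: acceptable_to_machines_def)
  then show ?thesis
    using not_worse_for_jobs_subset by (auto simp: pessimal_matching_def)
qed

text \<open>The dummy machine has room for all jobs together and therefore makes an offer to every
  job. The unique best offer is the match.\<close>

lemma pessimal_matching_ex1:
  assumes j: "j \<in> jobs I"
  shows "\<exists>!m. (j, m) \<in> pessimal_matching I"
proof -
  let ?S = "least_offers I"
  have sub: "?S \<subseteq> edges I"
    by (subst least_offers_unfold) (auto simp: acceptable_to_machines_def)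
  have "better_load I (not_worse_for_jobs I ?S) (dummy I) j \<le> (\<Sum>j\<in>jobs I. job_size I j)"
    unfolding better_load_def
  proof (rule sum_mono2[OF finite_jobs])
    show "{j'. (j', dummy I) \<in> not_worse_for_jobs I ?S \<and> (j', j) \<in> mach_pref I (dummy I)} \<subseteq> jobs I"
      using not_worse_for_jobs_subset edge_job by blast
  qed (use job_size_pos in \<open>auto intro: less_imp_le\<close>)
  then have "(j, dummy I) \<in> ?S"
    using dummy_cap dummy_edge[OF j]
    by (subst least_offers_unfold) (auto simp: acceptable_to_machines_def)
  moreover define B where "B = {m. (j, m) \<in> ?S}"
  ultimately have ne: "B \<noteq> {}" by auto
  have B: "B \<subseteq> adj_machines I j" using sub by (auto simp: B_def adj_machines_def)
  have "\<exists>w\<in>B. \<forall>a\<in>B. a \<noteq> w \<longrightarrow> (a, w) \<in> (job_pref I j)\<inverse>"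
  proof (rule finite_linear_order_greatest)
    show "finite B" using B finite_adj_machines finite_subset by blast
    show "total_on B ((job_pref I j)\<inverse>)"
      using job_pref_order(3)[OF j] B total_on_subset by auto
  qed (use ne job_pref_order(1)[OF j] in auto)
  then obtain w where w: "w \<in> B" "\<And>a. a \<in> B \<Longrightarrow> a \<noteq> w \<Longrightarrow> (w, a) \<in> job_pref I j"
    by auto
  have asym: "(a, b) \<in> job_pref I j \<Longrightarrow> (b, a) \<notin> job_pref I j" for a b
    using job_pref_order[OF j] by (meson irreflD transD)
  have irr: "(a, a) \<notin> job_pref I j" for a
    using asym by blast
  show ?thesis
  proof (rule ex1I)
    have "\<forall>m'. (j, m') \<in> ?S \<longrightarrow> (m', w) \<notin> job_pref I j"
      using w asym irr by (metis B_def mem_Collect_eq)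
    then show "(j, w) \<in> pessimal_matching I"
      using w(1) sub by (auto simp: pessimal_matching_def not_worse_for_jobs_def B_def)
  next
    fix m assume "(j, m) \<in> pessimal_matching I"
    then show "m = w"
      using w by (auto simp: pessimal_matching_def not_worse_for_jobs_def B_def)
  qed
qed

text \<open>A saturating load in the pool may include jobs that \<open>m\<close> rejects. The best
  rejected job above \<open>j\<close> was itself rejected because of better jobs filling
  \<open>m\<close>, and those are all matched to \<open>m\<close>.\<close>

lemma pessimal_matching_saturated:
  assumes edge: "(j, m) \<in> edges I"
    and full: "mach_cap I m \<le> better_load I (not_worse_for_jobs I (least_offers I)) m j"
  shows "mach_cap I m \<le> better_load I (pessimal_matching I) m j"
proof -
  let ?T = "not_worse_for_jobs I (least_offers I)"
  let ?Z = "pessimal_matching I"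
  note pref = mach_pref_order[OF edge_machine[OF edge]]
  have ZE: "?Z \<subseteq> edges I"
    using not_worse_for_jobs_subset by (auto simp: pessimal_matching_def)
  define R where "R = {j'. (j', m) \<in> ?T - ?Z \<and> (j', j) \<in> mach_pref I m}"
  show ?thesis
  proof (cases "R = {}")
    case True
    then have "{j'. (j', m) \<in> ?T \<and> (j', j) \<in> mach_pref I m}
        = {j'. (j', m) \<in> ?Z \<and> (j', j) \<in> mach_pref I m}"
      by (auto simp: R_def pessimal_matching_def)
    then show ?thesis using full by (simp add: better_load_def)
  next
    case False
    have R: "R \<subseteq> adj_jobs I m"
      using not_worse_for_jobs_subset by (auto simp: R_def adj_jobs_def)
    have "\<exists>w\<in>R. \<forall>a\<in>R. a \<noteq> w \<longrightarrow> (a, w) \<in> (mach_pref I m)\<inverse>"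
    proof (rule finite_linear_order_greatest)
      show "finite R" using R finite_adj_jobs finite_subset by blast
      show "total_on R ((mach_pref I m)\<inverse>)"
        using pref(3) R total_on_subset by auto
    qed (use False pref in auto)
    then obtain w where w: "w \<in> R" "\<And>a. a \<in> R \<Longrightarrow> a \<noteq> w \<Longrightarrow> (w, a) \<in> mach_pref I m"
      by auto
    have wj: "(w, j) \<in> mach_pref I m" using w(1) by (simp add: R_def)
    have "mach_cap I m \<le> better_load I ?T m w"
      using w(1) pessimal_matching_iff[of w m] by (auto simp: R_def)
    \<comment> \<open>By the choice of \<open>w\<close> as the best element of \<open>R\<close>, no
      job of the pool ranked above \<open>w\<close> is rejected.\<close>
    also have "\<dots> \<le> better_load I ?Z m j"
      unfolding better_load_def
    proof (rule sum_mono2)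
      show "finite {j'. (j', m) \<in> ?Z \<and> (j', j) \<in> mach_pref I m}"
        by (rule finite_matched[OF ZE])
      show "{j'. (j', m) \<in> ?T \<and> (j', w) \<in> mach_pref I m}
          \<subseteq> {j'. (j', m) \<in> ?Z \<and> (j', j) \<in> mach_pref I m}"
      proof clarify
        fix a assume a: "(a, m) \<in> ?T" "(a, w) \<in> mach_pref I m"
        have aj: "(a, j) \<in> mach_pref I m" using a(2) wj pref(1) by (meson transD)
        have "a \<noteq> w" "(w, a) \<notin> mach_pref I m"
          using a(2) pref by (meson irreflD transD)+
        then have "a \<notin> R" using w(2) by blast
        then show "(a, m) \<in> ?Z \<and> (a, j) \<in> mach_pref I m"
          using a aj by (simp add: R_def)
      qed
    qed (use matched_size_nonneg[OF ZE] in auto)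
    finally show ?thesis .
  qed
qed

lemma stable_pessimal_matching: "stable_matching I (pessimal_matching I)"
  unfolding stable_matching_def
proof (intro conjI allI impI ballI)
  show sub: "pessimal_matching I \<subseteq> edges I"
    using not_worse_for_jobs_subset by (auto simp: pessimal_matching_def)
  show "\<exists>!m. (j, m) \<in> pessimal_matching I" if "j \<in> jobs I" for j
    by (rule pessimal_matching_ex1[OF that])
  show "better_load I (pessimal_matching I) m j < mach_cap I m"
    if "(j, m) \<in> pessimal_matching I" for j m
  proof -
    have "better_load I (pessimal_matching I) m j
        \<le> better_load I (not_worse_for_jobs I (least_offers I)) m j"
      by (rule better_load_mono[OF _ not_worse_for_jobs_subset]) (auto simp: pessimal_matching_def)
    then show ?thesis using that pessimal_matching_iff by (meson le_less_trans)
  qed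
  show "(\<exists>m'. (j, m') \<in> pessimal_matching I \<and> (m', m) \<in> job_pref I j) \<or>
      mach_cap I m \<le> better_load I (pessimal_matching I) m j"
    if e: "(j, m) \<in> edges I - pessimal_matching I" for j m
  \<comment> \<open>Either the job would not refuse \<open>m\<close>, so \<open>m\<close> rejects it
    for lack of room, or the job has an offer better than \<open>m\<close> and its match is at least
    as good as that offer.\<close>
  proof (cases "(j, m) \<in> not_worse_for_jobs I (least_offers I)")
    case True
    then have "mach_cap I m \<le> better_load I (not_worse_for_jobs I (least_offers I)) m j"
      using e pessimal_matching_iff[of j m] by auto
    then show ?thesis using e pessimal_matching_saturated by blast
  next
    case False
    then obtain m' where m': "(j, m') \<in> least_offers I" "(m', m) \<in> job_pref I j"
      using e by (auto simp: not_worse_for_jobs_def)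
    have j: "j \<in> jobs I" using e edge_job by blast
    obtain w where w: "(j, w) \<in> pessimal_matching I"
      using pessimal_matching_ex1[OF j] by blast
    then have "(m', w) \<notin> job_pref I j"
      using m' by (auto simp: pessimal_matching_def not_worse_for_jobs_def)
    moreover have "(j, m') \<in> edges I"
      using m'(1) by (subst (asm) least_offers_unfold) (auto simp: acceptable_to_machines_def)
    ultimately have "m' = w \<or> (w, m') \<in> job_pref I j"
      using job_pref_order(3)[OF j] w sub by (auto simp: total_on_def adj_machines_def)
    then have "(w, m) \<in> job_pref I j"
      using m'(2) job_pref_order(1)[OF j] by (meson transD)
    then show ?thesis using w by blast
  qed
qed

text \<open>A stable matching \<open>A\<close> yields a prefixed point: the set of edges acceptable
  to the machines when the pool is \<open>?T\<close>. The least fixed point lies below it, and it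
  contains no edge that a job prefers to its edge in \<open>A\<close>.\<close>

lemma pessimal_matching_not_preferred:
  assumes stab: "stable_matching I A"
    and A: "(j, m) \<in> A" and Z: "(j, m') \<in> pessimal_matching I"
  shows "(m', m) \<notin> job_pref I j"
proof -
  let ?T = "not_worse_for_jobs I A"
  have AE: "A \<subseteq> edges I" and
    ex1: "\<And>j. j \<in> jobs I \<Longrightarrow> \<exists>!m. (j, m) \<in> A"
    using stab by (auto simp: stable_matching_def)
  have AT: "A \<subseteq> ?T"
  proof clarify
    fix j m assume "(j, m) \<in> A"
    moreover from this have "j \<in> jobs I" using AE edge_job by blast
    ultimately show "(j, m) \<in> ?T"
      using AE ex1[of j] job_pref_order(2)[of j] unfolding not_worse_for_jobs_def
      by (auto simp: irrefl_def)
  qed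
  \<comment> \<open>Stability of \<open>A\<close> at the unmatched edge to \<open>b\<close> gives
    better jobs filling \<open>b\<close> already within \<open>A\<close>, hence also within the
    larger pool \<open>?T\<close>.\<close>
  have rejected: "(j, b) \<notin> acceptable_to_machines I ?T"
    if "(j, a) \<in> A" "(b, a) \<in> job_pref I j" for j a b
  proof
    assume acc: "(j, b) \<in> acceptable_to_machines I ?T"
    then have e: "(j, b) \<in> edges I" by (auto simp: acceptable_to_machines_def)
    have j: "j \<in> jobs I" using e edge_job by blast
    have "(a, b) \<notin> job_pref I j" and "a \<noteq> b"
      using that(2) job_pref_order[OF j] by (meson irreflD transD)+
    then have "mach_cap I b \<le> better_load I A b j"
      using stab that(1) ex1[OF j] e unfolding stable_matching_def by blast
    also have "\<dots> \<le> better_load I ?T b j"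
      by (rule better_load_mono[OF AT not_worse_for_jobs_subset])
    finally show False using acc by (auto simp: acceptable_to_machines_def)
  qed
  \<comment> \<open>A job ranks its machines in \<open>?T\<close> no lower than its partner in
    \<open>A\<close>, so anything it likes still better is excluded by \<open>rejected\<close>.
    Applying the antitone operator to this inclusion gives the prefixed point property.\<close>
  have "?T \<subseteq> not_worse_for_jobs I (acceptable_to_machines I ?T)"
  proof clarify
    fix j b assume b: "(j, b) \<in> ?T"
    then have e: "(j, b) \<in> edges I" using not_worse_for_jobs_subset by blast
    have j: "j \<in> jobs I" using e edge_job by blast
    obtain a where a: "(j, a) \<in> A" using ex1[OF j] by blast
    have "(a, b) \<notin> job_pref I j" using a b by (auto simp: not_worse_for_jobs_def)
    then have "a = b \<or> (b, a) \<in> job_pref I j"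
      using job_pref_order(3)[OF j] a AE e by (auto simp: total_on_def adj_machines_def)
    then have "(c, a) \<in> job_pref I j" if "(c, b) \<in> job_pref I j" for c
      using that job_pref_order(1)[OF j] by (meson transD)
    then show "(j, b) \<in> not_worse_for_jobs I (acceptable_to_machines I ?T)"
      using e rejected[OF a] by (auto simp: not_worse_for_jobs_def)
  qed
  then have "better_load I ?T b i
      \<le> better_load I (not_worse_for_jobs I (acceptable_to_machines I ?T)) b i" for b i
    by (rule better_load_mono[OF _ not_worse_for_jobs_subset])
  then have "acceptable_to_machines I (not_worse_for_jobs I (acceptable_to_machines I ?T))
      \<subseteq> acceptable_to_machines I ?T"
    by (auto simp: acceptable_to_machines_def intro: le_less_trans)
  then have "least_offers I \<subseteq> acceptable_to_machines I ?T"
    unfolding least_offers_def by (rule lfp_lowerbound)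
  then show ?thesis
    using Z rejected[OF A] by (auto simp: pessimal_matching_def)
qed

section \<open>Correspondence between assignments and stable matchings\<close>

text \<open>Job sizes are positive, so the support determines an unsplit assignment on the
  edges.\<close>

lemma unsplit_eq_matching_assignment:
  assumes "unsplit I x" "e \<in> edges I"
  shows "x e = matching_assignment I (support I x) e"
proof (cases e)
  case (Pair j m)
  then have "x (j, m) = 0 \<or> x (j, m) = job_size I j" "0 < job_size I j"
    using assms job_size_pos[OF edge_job] by (auto simp: unsplit_def)
  then show ?thesis
    using assms(2) Pair by (auto simp: matching_assignment_def support_def)
qed

lemma mach_load_matching:
  assumes "unsplit I x"
  shows "mach_load I x m = (\<Sum>j | (j, m) \<in> support I x. job_size I j)"
proof -
  have "mach_load I x m
      = (\<Sum>j\<in>adj_jobs I m. if (j, m) \<in> support I x then job_size I j else 0)"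
    unfolding mach_load_def
    by (rule sum.cong) (auto simp: unsplit_eq_matching_assignment[OF assms] adj_jobs_def
        matching_assignment_def)
  also have "\<dots> = sum (job_size I) (adj_jobs I m \<inter> {j. (j, m) \<in> support I x})"
    using finite_adj_jobs by (simp add: sum.If_cases)
  also have "\<dots> = (\<Sum>j | (j, m) \<in> support I x. job_size I j)"
    by (rule sum.cong) (auto simp: adj_jobs_def support_def)
  finally show ?thesis .
qed

lemma better_sum_matching:
  assumes "unsplit I x"
  shows "(\<Sum>j' | j' \<in> adj_jobs I m \<and> (j', j) \<in> mach_pref I m. x (j', m))
    = better_load I (support I x) m j"
proof -
  have fin: "finite {j'. j' \<in> adj_jobs I m \<and> (j', j) \<in> mach_pref I m}"
    using finite_adj_jobs by simp
  have "(\<Sum>j' | j' \<in> adj_jobs I m \<and> (j', j) \<in> mach_pref I m. x (j', m))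
      = (\<Sum>j' | j' \<in> adj_jobs I m \<and> (j', j) \<in> mach_pref I m.
          if (j', m) \<in> support I x then job_size I j' else 0)"
    by (rule sum.cong) (auto simp: unsplit_eq_matching_assignment[OF assms] adj_jobs_def
        matching_assignment_def)
  also have "\<dots> = sum (job_size I) ({j'. j' \<in> adj_jobs I m \<and> (j', j) \<in> mach_pref I m}
      \<inter> {j'. (j', m) \<in> support I x})"
    using fin by (simp add: sum.If_cases)
  also have "\<dots> = better_load I (support I x) m j"
    unfolding better_load_def by (rule sum.cong) (auto simp: adj_jobs_def support_def)
  finally show ?thesis .
qed

text \<open>The job \<open>w\<close> is not counted in the better load. It will be the least liked
  job of \<open>m\<close>, whose size the relaxed capacity condition subtracts.\<close>

lemma better_load_le_load_minus:
  assumes A: "A \<subseteq> edges I" and w: "(w, m) \<in> A" "(w, j) \<notin> mach_pref I m"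
  shows "better_load I A m j \<le> (\<Sum>i | (i, m) \<in> A. job_size I i) - job_size I w"
proof -
  have fin: "finite {i. (i, m) \<in> A}" using finite_matched[OF A, of m "\<lambda>_. True"] by simp
  have "better_load I A m j \<le> (\<Sum>i\<in>{i. (i, m) \<in> A} - {w}. job_size I i)"
    unfolding better_load_def
  proof (rule sum_mono2)
    show "0 \<le> job_size I i"
      if "i \<in> {i. (i, m) \<in> A} - {w} - {i. (i, m) \<in> A \<and> (i, j) \<in> mach_pref I m}" for i
      using that matched_size_nonneg[OF A] by blast
  qed (use fin w in auto)
  then show ?thesis using fin w by (simp add: sum_diff1)
qed

text \<open>Existence of a partner comes from stability at the dummy edge, since the dummy machine
  cannot be saturated. The bound at the least liked job extends to all jobs of the machine.\<close>

lemma stable_matching_support: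
  assumes x: "relaxed_unsplit_stable I x"
  shows "stable_matching I (support I x)"
  unfolding stable_matching_def
proof (intro conjI allI impI ballI)
  have rel: "relaxed_unsplit I x" and u: "unsplit I x"
    using x by (auto simp: relaxed_unsplit_stable_def relaxed_unsplit_def)
  show sub: "support I x \<subseteq> edges I" by (auto simp: support_def)
  have stab: "(\<exists>m'. (j, m') \<in> support I x \<and> (m', m) \<in> job_pref I j) \<or>
      mach_cap I m \<le> better_load I (support I x) m j"
    if "(j, m) \<in> edges I - support I x" for j m
  proof -
    have "x (j, m) = 0"
      using that unsplit_eq_matching_assignment[OF u, of "(j, m)"]
      by (auto simp: matching_assignment_def)
    then have "(\<exists>m'\<in>adj_machines I j. x (j, m') > 0 \<and> (m', m) \<in> job_pref I j) \<or>
        (\<Sum>j' | j' \<in> adj_jobs I m \<and> (j', j) \<in> mach_pref I m. x (j', m)) \<ge> mach_cap I m"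
      using x that unfolding relaxed_unsplit_stable_def by blast
    then show ?thesis
      unfolding better_sum_matching[OF u] by (auto simp: adj_machines_def support_def)
  qed
  then show "(\<exists>m'. (j, m') \<in> support I x \<and> (m', m) \<in> job_pref I j) \<or>
      mach_cap I m \<le> better_load I (support I x) m j"
    if "(j, m) \<in> edges I - support I x" for j m
    using that .
  show "\<exists>!m. (j, m) \<in> support I x" if j: "j \<in> jobs I" for j
  proof (rule ex_ex1I)
    have "better_load I (support I x) (dummy I) j \<le> (\<Sum>j\<in>jobs I. job_size I j)"
      unfolding better_load_def
    proof (rule sum_mono2[OF finite_jobs])
      show "{j'. (j', dummy I) \<in> support I x \<and> (j', j) \<in> mach_pref I (dummy I)} \<subseteq> jobs I"
        using sub edge_job by blast
    qed (use job_size_pos in \<open>auto intro: less_imp_le\<close>)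
    then show "\<exists>m. (j, m) \<in> support I x"
      using stab[of j "dummy I"] dummy_cap dummy_edge[OF j] by force
  next
    fix a b assume ab: "(j, a) \<in> support I x" "(j, b) \<in> support I x"
    show "a = b"
    proof (rule ccontr)
      assume "a \<noteq> b"
      \<comment> \<open>Each of the two edges would carry the full positive size of
        \<open>j\<close>, exceeding the bound on the job load.\<close>
      then have "x (j, a) + x (j, b) = (\<Sum>m\<in>{a, b}. x (j, m))" by simp
      also have "\<dots> \<le> job_load I x j"
        unfolding job_load_def
        by (rule sum_mono2)
          (use ab u finite_adj_machines in
            \<open>auto simp: support_def adj_machines_def unsplit_def assignment_def\<close>)
      also have "\<dots> \<le> job_size I j" using u j by (auto simp: unsplit_def)
      finally have "x (j, a) + x (j, b) \<le> job_size I j" .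
      moreover have "x (j, m) = job_size I j" if "(j, m) \<in> support I x" for m
        using that sub unsplit_eq_matching_assignment[OF u, of "(j, m)"]
        by (auto simp: matching_assignment_def)
      ultimately show False using ab job_size_pos[OF j] by force
    qed
  qed
  show "better_load I (support I x) m j < mach_cap I m" if e: "(j, m) \<in> support I x" for j m
  proof -
    have m: "m \<in> machines I" using e sub edge_machine by blast
    note pref = mach_pref_order[OF m]
    have assd: "assigned_jobs I x m = {j. (j, m) \<in> support I x}"
      by (auto simp: assigned_jobs_def support_def adj_jobs_def)
    have "\<exists>w\<in>assigned_jobs I x m. \<forall>a\<in>assigned_jobs I x m. a \<noteq> w \<longrightarrow> (a, w) \<in> mach_pref I m"
    proof (rule finite_linear_order_greatest)
      show "finite (assigned_jobs I x m)"
        using finite_adj_jobs by (auto simp: assigned_jobs_def)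
      show "total_on (assigned_jobs I x m) (mach_pref I m)"
        using pref(3) by (rule total_on_subset) (auto simp: assigned_jobs_def)
    qed (use e assd pref in auto)
    then obtain w where w: "least_liked I x m w"
      by (auto simp: least_liked_def)
    then have wA: "(w, m) \<in> support I x" and "w = j \<or> (j, w) \<in> mach_pref I m"
      using e assd by (auto simp: least_liked_def)
    then have "(w, j) \<notin> mach_pref I m"
      using pref by (meson irreflD transD)
    then have "better_load I (support I x) m j \<le> mach_load I x m - job_size I w"
      using better_load_le_load_minus[OF sub wA] by (simp add: mach_load_matching[OF u])
    also have "\<dots> < mach_cap I m"
      using rel w m by (auto simp: relaxed_unsplit_def)
    finally show ?thesis .
  qed
qed

lemma support_matching_assignment:
  assumes "A \<subseteq> edges I"
  shows "support I (matching_assignment I A) = A"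
  using assms job_size_pos[OF edge_job]
  by (auto simp: support_def matching_assignment_def split: if_splits)

text \<open>This direction makes the fixed point a competitor to which machine optimality can be
  applied.\<close>

lemma relaxed_unsplit_stable_matching_assignment:
  assumes A: "stable_matching I A"
  shows "relaxed_unsplit_stable I (matching_assignment I A)"
proof -
  let ?x = "matching_assignment I A"
  have AE: "A \<subseteq> edges I" and ex1: "\<And>j. j \<in> jobs I \<Longrightarrow> \<exists>!m. (j, m) \<in> A"
    using A by (auto simp: stable_matching_def)
  note supp = support_matching_assignment[OF AE]
  have u: "unsplit I ?x"
    unfolding unsplit_def
  proof (intro conjI ballI)
    show "assignment I ?x"
      using job_size_pos[OF edge_job]
      by (auto simp: assignment_def matching_assignment_def less_imp_le)
    show "case e of (j, m) \<Rightarrow> ?x (j, m) \<in> {0, job_size I j}" for e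
      by (auto simp: matching_assignment_def)
    show "job_load I ?x j \<le> job_size I j" if j: "j \<in> jobs I" for j
    proof -
      obtain w where w: "\<And>m. (j, m) \<in> A \<longleftrightarrow> m = w" using ex1[OF j] by metis
      show ?thesis
        using finite_adj_machines job_size_pos[OF j]
        by (auto simp: job_load_def matching_assignment_def w)
    qed
  qed
  have "relaxed_unsplit I ?x"
    unfolding relaxed_unsplit_def
  proof (intro conjI ballI allI impI u)
    fix m j assume m: "m \<in> machines I" and l: "least_liked I ?x m j"
    have assd: "assigned_jobs I ?x m = {j. (j, m) \<in> A}"
      using supp by (auto simp: assigned_jobs_def support_def adj_jobs_def)
    then have jA: "(j, m) \<in> A" and
      least: "\<And>i. (i, m) \<in> A \<Longrightarrow> i \<noteq> j \<Longrightarrow> (i, j) \<in> mach_pref I m"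
      using l by (auto simp: least_liked_def)
    have fin: "finite {i. (i, m) \<in> A}" using finite_matched[OF AE, of m "\<lambda>_. True"] by simp
    \<comment> \<open>At the least liked job, the better jobs are all the other ones, so the two
      forms of the capacity condition agree.\<close>
    have "{i. (i, m) \<in> A \<and> (i, j) \<in> mach_pref I m} = {i. (i, m) \<in> A} - {j}"
      using least mach_pref_order(2)[OF m] by (auto simp: irrefl_def)
    then have "mach_load I ?x m - job_size I j = better_load I A m j"
      using fin jA by (simp add: mach_load_matching[OF u] supp better_load_def sum_diff1)
    then show "mach_load I ?x m - job_size I j < mach_cap I m"
      using A jA by (simp add: stable_matching_def)
  qed
  moreover have "(\<exists>m'\<in>adj_machines I j. ?x (j, m') > 0 \<and> (m', m) \<in> job_pref I j) \<or>
        (\<Sum>j' | j' \<in> adj_jobs I m \<and> (j', j) \<in> mach_pref I m. ?x (j', m)) \<ge> mach_cap I m"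
    if e: "(j, m) \<in> edges I" and z: "?x (j, m) = 0" for j m
  proof -
    have "(j, m) \<notin> A" using z job_size_pos[OF edge_job[OF e]]
      by (auto simp: matching_assignment_def)
    then have "(\<exists>m'. (j, m') \<in> A \<and> (m', m) \<in> job_pref I j) \<or> mach_cap I m \<le> better_load I A m j"
      using A e by (simp add: stable_matching_def)
    then show ?thesis
      unfolding better_sum_matching[OF u] supp
      using AE job_size_pos[OF edge_job[OF e]]
      by (auto simp: adj_machines_def matching_assignment_def)
  qed
  ultimately show ?thesis
    unfolding relaxed_unsplit_stable_def by blast
qed

section \<open>The machine-optimal assignment is job-pessimal\<close>

text \<open>If the two differ at \<open>m\<close>, the best differing job \<open>j\<close> is
  assigned to \<open>m\<close> by \<open>x\<close>. Stability and job-pessimality of the fixed point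
  force better jobs to fill \<open>m\<close>, while \<open>x\<close> leaves room above
  \<open>j\<close>.\<close>

lemma machine_optimal_support:
  assumes x: "machine_optimal I x"
  shows "support I x = pessimal_matching I"
proof -
  let ?Z = "pessimal_matching I"
  let ?z = "matching_assignment I ?Z"
  have X: "stable_matching I (support I x)"
    using x stable_matching_support by (simp add: machine_optimal_def)
  have Z: "stable_matching I ?Z" by (rule stable_pessimal_matching)
  have ZE: "?Z \<subseteq> edges I" using Z by (simp add: stable_matching_def)
  have diff: "differing_jobs I m x ?z = {j. ((j, m) \<in> support I x) \<noteq> ((j, m) \<in> ?Z)}" for m
    using support_matching_assignment[OF ZE] by (auto simp: differing_jobs_def support_def adj_jobs_def)
  have "differing_jobs I m x ?z = {}" if m: "m \<in> machines I" for m
  proof (rule ccontr)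
    assume ne: "differing_jobs I m x ?z \<noteq> {}"
    have "weakly_prefers I m x ?z"
      using x m relaxed_unsplit_stable_matching_assignment[OF Z] by (simp add: machine_optimal_def)
    then obtain j where j: "j \<in> differing_jobs I m x ?z" "x (j, m) > 0"
      and top: "\<And>i. i \<in> differing_jobs I m x ?z \<Longrightarrow> i \<noteq> j \<Longrightarrow> (j, i) \<in> mach_pref I m"
      using ne by (auto simp: weakly_prefers_def)
    have "j \<in> adj_jobs I m" using j(1) by (simp add: differing_jobs_def)
    then have jX: "(j, m) \<in> support I x" and jZ: "(j, m) \<notin> ?Z"
      using j unfolding diff by (auto simp: adj_jobs_def support_def)
    have e: "(j, m) \<in> edges I" using jX by (simp add: support_def)
    have "mach_cap I m \<le> better_load I ?Z m j"
      using Z e jZ pessimal_matching_not_preferred[OF X jX] unfolding stable_matching_def by blast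
    \<comment> \<open>Above the best differing job both matchings assign the same jobs to
      \<open>m\<close>.\<close>
    also have "\<dots> = better_load I (support I x) m j"
    proof -
      have "i \<notin> differing_jobs I m x ?z" if "(i, j) \<in> mach_pref I m" for i
        using top[of i] that mach_pref_order(1,2)[OF m] by (metis irreflD transD)
      then have "{i. (i, m) \<in> ?Z \<and> (i, j) \<in> mach_pref I m}
          = {i. (i, m) \<in> support I x \<and> (i, j) \<in> mach_pref I m}"
        unfolding diff by auto
      then show ?thesis by (simp add: better_load_def)
    qed
    also have "\<dots> < mach_cap I m"
      using X jX by (simp add: stable_matching_def)
    finally show False by simp
  qed
  then show ?thesis
    unfolding diff using ZE edge_machine by (fastforce simp: support_def)
qed

section \<open>Comparison of congestion\<close>

text \<open>Double counting: every job is placed on exactly one machine with its full size.\<close>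

lemma sum_mach_load:
  assumes x: "relaxed_unsplit_stable I x"
  shows "(\<Sum>m\<in>machines I. mach_load I x m) = (\<Sum>j\<in>jobs I. job_size I j)"
proof -
  let ?A = "support I x"
  have u: "unsplit I x"
    using x by (auto simp: relaxed_unsplit_stable_def relaxed_unsplit_def)
  have A: "?A \<subseteq> edges I" and ex1: "\<And>j. j \<in> jobs I \<Longrightarrow> \<exists>!m. (j, m) \<in> ?A"
    using stable_matching_support[OF x] by (auto simp: stable_matching_def)
  have "(\<Sum>m\<in>machines I. mach_load I x m)
      = (\<Sum>m\<in>machines I. \<Sum>j | j \<in> jobs I \<and> (j, m) \<in> ?A. job_size I j)"
    unfolding mach_load_matching[OF u]
    by (intro sum.cong refl) (use A edge_job in auto)
  also have "\<dots> = (\<Sum>j\<in>jobs I. \<Sum>m | m \<in> machines I \<and> (j, m) \<in> ?A. job_size I j)"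
    by (rule sum.swap_restrict[OF finite_machines finite_jobs])
  also have "\<dots> = (\<Sum>j\<in>jobs I. job_size I j)"
  proof (rule sum.cong[OF refl])
    fix j assume "j \<in> jobs I"
    then obtain w where w: "\<And>m. (j, m) \<in> ?A \<longleftrightarrow> m = w" using ex1 by metis
    then have "{m. m \<in> machines I \<and> (j, m) \<in> ?A} = {w}"
      using A edge_machine by auto
    then show "(\<Sum>m | m \<in> machines I \<and> (j, m) \<in> ?A. job_size I j) = job_size I j" by simp
  qed
  finally show ?thesis .
qed

text \<open>Either \<open>m\<close> keeps all its jobs from \<open>y\<close>, so its load does not
  drop, or some job is lost and \<open>m\<close> turns out to be saturated in
  \<open>x\<close>.\<close>

lemma machine_optimal_min_load:
  assumes x: "machine_optimal I x" and y: "relaxed_unsplit_stable I y"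
  shows "min (mach_load I y m) (mach_cap I m) \<le> min (mach_load I x m) (mach_cap I m)"
proof -
  have sx: "relaxed_unsplit_stable I x" using x by (simp add: machine_optimal_def)
  have ux: "unsplit I x" and uy: "unsplit I y"
    using sx y by (auto simp: relaxed_unsplit_stable_def relaxed_unsplit_def)
  let ?X = "support I x" and ?Y = "support I y"
  have X: "stable_matching I ?X" and Y: "stable_matching I ?Y"
    using stable_matching_support sx y by auto
  have XE: "?X \<subseteq> edges I" and YE: "?Y \<subseteq> edges I" by (auto simp: support_def)
  have finX: "finite {j. (j, m) \<in> ?X}" using finite_matched[OF XE, of m "\<lambda>_. True"] by simp
  have pos: "0 \<le> job_size I j" if "(j, m) \<in> ?X" for j
    using matched_size_nonneg[OF XE that] .
  show ?thesis
  proof (cases "{j. (j, m) \<in> ?Y} \<subseteq> {j. (j, m) \<in> ?X}")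
    case True
    then have "mach_load I y m \<le> mach_load I x m"
      unfolding mach_load_matching[OF ux] mach_load_matching[OF uy]
      by (intro sum_mono2 finX) (use pos in auto)
    then show ?thesis by auto
  next
    case False
    then obtain j where jY: "(j, m) \<in> ?Y" and jX: "(j, m) \<notin> ?X" by auto
    \<comment> \<open>By job-pessimality the lost job does not improve on \<open>m\<close> in
      \<open>x\<close>, so stability of \<open>x\<close> leaves only saturation of
      \<open>m\<close>.\<close>
    have "\<not> (\<exists>m'. (j, m') \<in> ?X \<and> (m', m) \<in> job_pref I j)"
      using pessimal_matching_not_preferred[OF Y jY] machine_optimal_support[OF x] by auto
    then have "mach_cap I m \<le> better_load I ?X m j"
      using X jX jY YE unfolding stable_matching_def by blast
    also have "\<dots> \<le> mach_load I x m"
      unfolding mach_load_matching[OF ux] better_load_def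
      by (intro sum_mono2 finX) (use pos in auto)
    finally show ?thesis by auto
  qed
qed

text \<open>Excess over capacity is load minus the minimum of load and capacity, and the total load
  is the same for all stable assignments.\<close>

lemma total_congestion_eq:
  assumes "relaxed_unsplit_stable I x"
  shows "total_congestion I x
    = (\<Sum>j\<in>jobs I. job_size I j) - (\<Sum>m\<in>machines I. min (mach_load I x m) (mach_cap I m))"
proof -
  have "total_congestion I x
      = (\<Sum>m\<in>machines I. mach_load I x m - min (mach_load I x m) (mach_cap I m))"
    unfolding total_congestion_def by (rule sum.cong) auto
  then show ?thesis by (simp add: sum_subtractf sum_mach_load[OF assms])
qed

lemma machine_optimal_total_congestion_le:
  assumes x: "machine_optimal I x" and y: "relaxed_unsplit_stable I y"
  shows "total_congestion I x \<le> total_congestion I y"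
proof -
  have "relaxed_unsplit_stable I x" using x by (simp add: machine_optimal_def)
  then show ?thesis
    using total_congestion_eq y sum_mono[OF machine_optimal_min_load[OF x y]] by simp
qed

end

theorem theorem4:
  fixes I :: "('j, 'm) alloc_inst" and x_mopt :: "'j \<times> 'm \<Rightarrow> real"
  assumes "valid_inst I"
    and "machine_optimal I x_mopt"
  shows "is_arg_min (total_congestion I) (relaxed_unsplit_stable I) x_mopt"
proof -
  interpret valid_instance I by unfold_locales fact
  show ?thesis
    using assms(2) machine_optimal_total_congestion_le
    by (auto simp: is_arg_min_def machine_optimal_def not_less)
qed

end
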